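(* Let $(m,n,r)$ be a triple of natural numbers with $m,n\ge 1$, $\gcd(m,n)=\gcd(m,r-1)=1$ and $r^n\equiv 1 \pmod m$, and let $ZM(m,n,r)=\langle a,b \mid a^m=b^n=1,\ b^{-1}ab=a^r\rangle$. Then the factorization number of $ZM(m,n,r)$ is $$F_2(ZM(m,n,r))=\sum_{\substack{m_2\mid m,\ m_3\mid m\\ n_2\mid n,\ n_3\mid n\\ \gcd(m_2,m_3)=1\\ \gcd(n_2,n_3)=1}}\gcd\left(m_2,\frac{r^n-1}{r^{n_2}-1}\right)\gcd\left(m_3,\frac{r^n-1}{r^{n_3}-1}\right),$$ where the sum runs over all quadruples $(m_2,m_3,n_2,n_3)$ of positive integers satisfying the listed conditions. In particular, $F_2(ZM(9,4,8))=85$.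
   Context: For a finite group $G$, $L(G)$ denotes the set (lattice) of all subgroups of $G$, and the factorization number of $G$ is $F_2(G)=|\{(H,K)\in L(G)^2 \mid HK=G\}|$ (ordered pairs), where $HK=\{hk\mid h\in H,k\in K\}$. A ZM-group $ZM(m,n,r)$ is the finite group of order $mn$ given by the presentation in the claim under the stated conditions on $(m,n,r)$. When $r=1$ (which forces $m=1$), the quotient $\frac{r^n-1}{r^{k}-1}$, for $k\mid n$, is read as $\sum_{i=0}^{n/k-1} r^{ik}$. *)

theory Defs
  imports "HOL-Algebra.Coset" "HOL-Number_Theory.Cong"
begin

definition subgroup_set :: "('a, 'b) monoid_scheme \<Rightarrow> 'a set set" where
  "subgroup_set G = {H. subgroup H G}"

definition factorization_number :: "('a, 'b) monoid_scheme \<Rightarrow> nat" where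
  "factorization_number G =
     card {(H, K). H \<in> subgroup_set G \<and> K \<in> subgroup_set G \<and> H <#>\<^bsub>G\<^esub> K = carrier G}"

section \<open>Groups given by generators and relations\<close>

text \<open>
  The generators are all elements of the type \<open>'g\<close>. The letter \<open>(x, True)\<close> stands for \<open>x\<close>
  and \<open>(x, False)\<close> for its formal inverse; a pair \<open>(u, v)\<close> in \<open>R\<close> stands for the relation
  \<open>u = v\<close>.
\<close>

type_synonym 'g gword = "('g \<times> bool) list"

inductive pres_eq :: "('g gword \<times> 'g gword) set \<Rightarrow> 'g gword \<Rightarrow> 'g gword \<Rightarrow> bool"
  for R :: "('g gword \<times> 'g gword) set" where
  refl: "pres_eq R u u"
| sym: "pres_eq R u v \<Longrightarrow> pres_eq R v u"
| trans: "pres_eq R u v \<Longrightarrow> pres_eq R v w \<Longrightarrow> pres_eq R u w"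
| cancel: "pres_eq R (p @ [(x, s), (x, \<not> s)] @ q) (p @ q)"
| relation: "(u, v) \<in> R \<Longrightarrow> pres_eq R (p @ u @ q) (p @ v @ q)"

definition pres_rel :: "('g gword \<times> 'g gword) set \<Rightarrow> ('g gword \<times> 'g gword) set" where
  "pres_rel R = {(u, v). pres_eq R u v}"

definition presented_group :: "('g gword \<times> 'g gword) set \<Rightarrow> 'g gword set monoid" where
  "presented_group R =
     \<lparr>carrier = UNIV // pres_rel R,
      monoid.mult = (\<lambda>U V. \<Union>u\<in>U. \<Union>v\<in>V. pres_rel R `` {u @ v}),
      one = pres_rel R `` {[]}\<rparr>"

lemma equiv_pres_rel: "equiv UNIV (pres_rel R)"
  by (auto simp: equiv_def refl_on_def sym_def trans_def pres_rel_def
           intro: pres_eq.refl pres_eq.sym pres_eq.trans)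

lemma pres_eq_context: "pres_eq R u v \<Longrightarrow> pres_eq R (p @ u @ q) (p @ v @ q)"
proof (induction rule: pres_eq.induct)
  case (cancel p' x s q')
  show ?case using pres_eq.cancel[of R "p @ p'" x s "q' @ q"] by simp
next
  case (relation u v p' q')
  then show ?case using pres_eq.relation[of u v R "p @ p'" "q' @ q"] by simp
qed (blast intro: pres_eq.refl pres_eq.sym pres_eq.trans)+

lemma pres_eq_append: "pres_eq R u u' \<Longrightarrow> pres_eq R v v' \<Longrightarrow> pres_eq R (u @ v) (u' @ v')"
  using pres_eq_context[of R u u' "[]" v] pres_eq_context[of R v v' u' "[]"]
  by (auto intro: pres_eq.trans)

lemma presented_group_mult:
  "pres_rel R `` {u} \<otimes>\<^bsub>presented_group R\<^esub> pres_rel R `` {v} = pres_rel R `` {u @ v}"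
proof -
  have "(\<lambda>u v. pres_rel R `` {u @ v}) respects2 pres_rel R"
    by (intro congruent2I'[where ?r1.0 = "pres_rel R"] equiv_class_eq[OF equiv_pres_rel])
       (auto simp: pres_rel_def intro: pres_eq_append)
  then show ?thesis
    using UN_equiv_class2[OF equiv_pres_rel[of R] equiv_pres_rel[of R]]
    by (simp add: presented_group_def)
qed

lemma presented_group_carrierE:
  assumes "U \<in> carrier (presented_group R)"
  obtains u where "U = pres_rel R `` {u}"
  using assms by (auto simp: presented_group_def elim: quotientE)

lemma presented_group_class_in_carrier [simp]:
  "pres_rel R `` {u} \<in> carrier (presented_group R)"
  by (simp add: presented_group_def quotientI)

lemma pres_eq_inverse:
  "pres_eq R (rev (map (\<lambda>(x, s). (x, \<not> s)) w) @ w) []"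
proof (induction w)
  case Nil
  show ?case by (simp add: pres_eq.refl)
next
  case (Cons a w)
  obtain x s where a: "a = (x, s)" by (cases a)
  show ?case
    using pres_eq.cancel[of R "rev (map (\<lambda>(x, s). (x, \<not> s)) w)" x "\<not> s" w] Cons.IH
    by (auto simp: a intro: pres_eq.trans)
qed

lemma group_presented_group: "group (presented_group R)"
proof (rule groupI)
  have one: "\<one>\<^bsub>presented_group R\<^esub> = pres_rel R `` {[]}"
    by (simp add: presented_group_def)
  show "\<one>\<^bsub>presented_group R\<^esub> \<in> carrier (presented_group R)"
    by (simp add: one)
  show "x \<otimes>\<^bsub>presented_group R\<^esub> y \<in> carrier (presented_group R)"
    if "x \<in> carrier (presented_group R)" "y \<in> carrier (presented_group R)" for x y
    using that by (auto elim!: presented_group_carrierE simp: presented_group_mult)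
  show "x \<otimes>\<^bsub>presented_group R\<^esub> y \<otimes>\<^bsub>presented_group R\<^esub> z =
        x \<otimes>\<^bsub>presented_group R\<^esub> (y \<otimes>\<^bsub>presented_group R\<^esub> z)"
    if "x \<in> carrier (presented_group R)" "y \<in> carrier (presented_group R)"
       "z \<in> carrier (presented_group R)" for x y z
    using that by (auto elim!: presented_group_carrierE simp: presented_group_mult)
  show "\<one>\<^bsub>presented_group R\<^esub> \<otimes>\<^bsub>presented_group R\<^esub> x = x"
    if "x \<in> carrier (presented_group R)" for x
    using that by (auto elim!: presented_group_carrierE simp: presented_group_mult one)
  show "\<exists>y\<in>carrier (presented_group R). y \<otimes>\<^bsub>presented_group R\<^esub> x = \<one>\<^bsub>presented_group R\<^esub>"
    if x: "x \<in> carrier (presented_group R)" for x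
  proof -
    obtain w where w: "x = pres_rel R `` {w}"
      using x by (rule presented_group_carrierE)
    have "pres_rel R `` {rev (map (\<lambda>(x, s). (x, \<not> s)) w) @ w} = pres_rel R `` {[]}"
      by (intro equiv_class_eq[OF equiv_pres_rel]) (simp add: pres_rel_def pres_eq_inverse)
    then show ?thesis
      by (intro bexI[of _ "pres_rel R `` {rev (map (\<lambda>(x, s). (x, \<not> s)) w)}"])
         (simp_all add: w presented_group_mult one)
  qed
qed

section \<open>ZM-groups\<close>

datatype zm_gen = Gen_a | Gen_b

definition zm_relations :: "nat \<Rightarrow> nat \<Rightarrow> nat \<Rightarrow> (zm_gen gword \<times> zm_gen gword) set" where
  "zm_relations m n r =
     {(replicate m (Gen_a, True), []),
      (replicate n (Gen_b, True), []),
      ([(Gen_b, False), (Gen_a, True), (Gen_b, True)], replicate r (Gen_a, True))}"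

definition ZM :: "nat \<Rightarrow> nat \<Rightarrow> nat \<Rightarrow> zm_gen gword set monoid" where
  "ZM m n r = presented_group (zm_relations m n r)"

text \<open>
  The quotient \<open>(r ^ n - 1) / (r ^ k - 1)\<close>, used only for \<open>k dvd n\<close> with \<open>n \<ge> 1\<close>, where the
  integer division is exact. It is taken over the integers because \<open>r = 0\<close> is allowed, and
  \<open>r = 1\<close> needs a separate convention.
\<close>

definition zm_quotient :: "nat \<Rightarrow> nat \<Rightarrow> nat \<Rightarrow> int" where
  "zm_quotient r n k =
     (if r = 1 then (\<Sum>i<n div k. int r ^ (i * k)) else (int r ^ n - 1) div (int r ^ k - 1))"

end

theory Submission
  imports Defs
begin

text \<open>
  Every element of the group has a normal form \<open>b ^ k * a ^ l\<close>, with \<open>k\<close> unique modulo \<open>n\<close> and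
  \<open>l\<close> unique modulo \<open>m\<close>. A subgroup \<open>H\<close> is determined by the \<open>m1 dvd m\<close> with
  \<open>H \<inter> <a> = <a ^ m1>\<close>, the \<open>d dvd n\<close> such that \<open>b ^ d\<close> generates the image of \<open>H\<close> modulo \<open><a>\<close>,
  and the residue \<open>s\<close> modulo \<open>m1\<close> with \<open>b ^ d * a ^ s \<in> H\<close>. The power of \<open>b ^ d * a ^ s\<close> with
  exponent \<open>n div d\<close> lies in \<open><a>\<close>, which forces \<open>m1 dvd s * (r ^ n - 1) / (r ^ d - 1)\<close>; this
  leaves \<open>gcd m1 ((r ^ n - 1) / (r ^ d - 1))\<close> choices of \<open>s\<close>.

  Two subgroups satisfy \<open>H K = G\<close> iff their parameters \<open>m1\<close> are coprime and their parameters
  \<open>d\<close> are coprime. If a prime \<open>p\<close> divides both \<open>m1\<close>, then modulo \<open>a ^ p\<close> each of \<open>H\<close> and \<open>K\<close> lies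
  in a conjugate of the complement \<open><b>\<close>, and two conjugates of a proper subgroup never
  multiply to the whole group.
\<close>

section \<open>Arithmetic\<close>


text \<open>Equals \<open>(r ^ (d * j) - 1) / (r ^ d - 1)\<close> when the denominator is nonzero.
  As a sum it also covers \<open>r = 1\<close> and needs no division.\<close>

definition gsum :: "nat \<Rightarrow> nat \<Rightarrow> nat \<Rightarrow> int" where
  "gsum r d j = (\<Sum>i<j. int r ^ (d * i))"

lemma gsum_0 [simp]: "gsum r d 0 = 0"
  and gsum_Suc: "gsum r d (Suc j) = gsum r d j + int r ^ (d * j)"
  and gsum_Suc_0 [simp]: "gsum r d (Suc 0) = 1"
  by (simp_all add: gsum_def)

text \<open>Splits off the first \<open>j\<close> terms. The right side is the exponent of
  \<open>a\<close> in the product of the powers \<open>i\<close> and \<open>j\<close> of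
  \<open>b ^ d * a\<close>.\<close>

lemma gsum_add: "gsum r d (i + j) = gsum r d i * int r ^ (d * j) + gsum r d j"
  by (induction i) (simp_all add: gsum_Suc algebra_simps flip: power_add)

lemma gsum_mult: "(int r ^ d - 1) * gsum r d j = int r ^ (d * j) - 1"
  by (induction j) (simp_all add: gsum_Suc algebra_simps power_add)

lemma zm_quotient_eq_gsum:
  assumes "n \<ge> 1" "d dvd n"
  shows "zm_quotient r n d = gsum r d (n div d)"
proof (cases "r = 1")
  case True
  then show ?thesis by (simp add: zm_quotient_def gsum_def)
next
  case False
  have "d > 0" using assms by (auto intro: Nat.gr0I)
  then have "int r ^ d \<noteq> 1"
    using False power_inject_base[of "int r" "d - 1" 1] by auto
  moreover have "int r ^ n - 1 = (int r ^ d - 1) * gsum r d (n div d)"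
    using assms by (simp add: gsum_mult)
  ultimately show ?thesis using False by (simp add: zm_quotient_def)
qed

text \<open>Cancelling \<open>g\<close> leaves coprime cofactors, so the condition becomes
  \<open>M / g\<close> dividing \<open>s\<close>; exactly \<open>g\<close> multiples of
  \<open>M / g\<close> lie in \<open>[0, M)\<close>.\<close>

lemma card_solutions_dvd:
  fixes Q :: int and M :: nat
  assumes "M \<ge> 1"
  shows "int (card {s::int. 0 \<le> s \<and> s < int M \<and> int M dvd s * Q}) = gcd (int M) Q"
proof -
  define g where "g = gcd (int M) Q"
  define q where "q = int M div g"
  have g: "g > 0" using assms by (simp add: g_def)
  have Mq: "int M = q * g" by (simp add: q_def g_def)
  have q: "q > 0" using Mq g assms by (metis less_eq_Suc_le One_nat_def of_nat_0_less_iff zero_less_mult_pos2)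
  obtain Q' where Q': "Q = Q' * g" by (metis g_def gcd_dvd2 dvd_div_mult_self)
  have cop: "coprime q Q'"
    using div_gcd_coprime[of "int M" Q] g assms Q' unfolding q_def g_def[symmetric] by simp
  have dvd_iff: "int M dvd s * Q \<longleftrightarrow> q dvd s" for s
    using g cop by (simp add: Mq Q' coprime_dvd_mult_left_iff flip: mult.assoc)
  have "{s::int. 0 \<le> s \<and> s < int M \<and> int M dvd s * Q} = (\<lambda>i. q * i) ` {0..<g}"
    unfolding dvd_iff using q by (force simp: Mq zero_le_mult_iff elim!: dvdE)
  moreover have "inj_on (\<lambda>i. q * i) {0..<g}" using q by (auto simp: inj_on_def)
  ultimately show ?thesis using g by (simp add: card_image g_def)
qed

text \<open>The closure conditions make \<open>I\<close> an ideal of the integers, generated by its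
  least positive element. It is applied to the exponents of \<open>a\<close> and of \<open>b\<close>
  in a subgroup.\<close>

lemma add_closed_eq_multiples:
  fixes I :: "int set" and n :: nat
  assumes n: "n \<ge> 1" "int n \<in> I"
    and add: "\<And>x y. x \<in> I \<Longrightarrow> y \<in> I \<Longrightarrow> x + y \<in> I"
    and cong: "\<And>x y. x \<in> I \<Longrightarrow> [x = y] (mod int n) \<Longrightarrow> y \<in> I"
  obtains d :: nat where "d dvd n" "I = {x. int d dvd x}"
proof -
  have zero: "0 \<in> I" using cong[OF n(2), of 0] by (simp add: cong_def)
  have nat_mult: "int j * x \<in> I" if "x \<in> I" for x j
    using that zero by (induction j) (auto simp: distrib_right intro: add)
  have int_mult: "c * x \<in> I" if "x \<in> I" for x c
  proof -
    \<comment> \<open>A negative coefficient is replaced by its residue modulo \<open>n\<close>, so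
      repeated addition suffices.\<close>
    have "int (nat (c mod int n)) * x \<in> I" by (rule nat_mult[OF that])
    then show ?thesis
      using n(1) by (elim cong) (auto simp: cong_def mod_simps)
  qed
  define d where "d = (LEAST d. d > 0 \<and> int d \<in> I)"
  have d: "d > 0" "int d \<in> I"
    using LeastI[of "\<lambda>d. d > 0 \<and> int d \<in> I" n] n by (auto simp: d_def)
  have "int d dvd x" if "x \<in> I" for x
  proof -
    have "x + (- (x div int d)) * int d \<in> I" using that d int_mult add by blast
    then have "x mod int d \<in> I" by (simp add: minus_div_mult_eq_mod[symmetric])
    moreover have "0 \<le> x mod int d" "x mod int d < int d" using d by simp_all
    ultimately have "x mod int d = 0"
      using not_less_Least[of "nat (x mod int d)" "\<lambda>d. d > 0 \<and> int d \<in> I"]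
      by (auto simp: d_def[symmetric])
    then show ?thesis by auto
  qed
  then have "I = {x. int d dvd x}" using int_mult[OF d(2)] by (auto elim!: dvdE simp: mult.commute)
  moreover from this have "d dvd n" using n by auto
  ultimately show ?thesis using that by blast
qed

section \<open>Subgroups and their products\<close>

text \<open>
  \<open>e k l\<close> stands for \<open>b ^ k * a ^ l\<close>. Leaving \<open>k\<close> and \<open>l\<close> unreduced keeps all \<open>mod\<close> operations out of
  the multiplication rule.
\<close>

locale zm_group = group G for G (structure) +
  fixes e :: "nat \<Rightarrow> int \<Rightarrow> 'a" and m n r :: nat
  assumes m_pos: "m \<ge> 1" and n_pos: "n \<ge> 1"
    and coprime_mn: "coprime m n"
    and r_pow: "[int r ^ n = 1] (mod int m)"
    and carrier_eq: "carrier G = {e k l | k l. True}"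
    and e_mult: "e k l \<otimes> e k' l' = e (k + k') (l * int r ^ k' + l')"
    and e_eq_iff: "e k l = e k' l' \<longleftrightarrow> [k = k'] (mod n) \<and> [l = l'] (mod int m)"
begin

lemma e_closed [simp, intro]: "e k l \<in> carrier G"
  by (auto simp: carrier_eq)

lemma e_0_0: "e 0 0 = \<one>"
  using e_mult[of 0 0 0 0] by (simp add: l_cancel_one')

lemma e_mod_n: "e (k + n * j) l = e k l"
  by (simp add: e_eq_iff cong_def)

lemma r_pow_mult: "[int r ^ (n * j) = 1] (mod int m)"
  using cong_pow[OF r_pow, of j] by (simp add: power_mult)

lemma coprime_r: "coprime (int r) (int m)"
proof -
  have "coprime (int r ^ n) (int m)"
    using r_pow by (metis cong_imp_coprime cong_sym coprime_1_left)
  then show ?thesis using n_pos by (simp add: coprime_power_left_iff)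
qed

section \<open>Parameters of subgroups\<close>

text \<open>The \<open>j\<close>-th power of \<open>b ^ d * a ^ s\<close> is \<open>b ^ (d * j) * a ^ (s * gsum r d j)\<close>.\<close>

definition zm_subgroup :: "nat \<Rightarrow> nat \<Rightarrow> int \<Rightarrow> 'a set" where
  "zm_subgroup m1 d s = {e (d * j) l | j l. [l = s * gsum r d j] (mod int m1)}"

text \<open>The last condition puts the power of \<open>e d s\<close> with exponent
  \<open>n div d\<close>, an element of \<open><a>\<close>, into \<open><a ^ m1>\<close>. Only the
  residue of \<open>s\<close> modulo \<open>m1\<close> matters.\<close>

definition zm_triple :: "nat \<Rightarrow> nat \<Rightarrow> int \<Rightarrow> bool" where
  "zm_triple m1 d s \<longleftrightarrow> m1 dvd m \<and> d dvd n \<and> int m1 dvd s * gsum r d (n div d)"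

lemma zm_triple_pos: "zm_triple m1 d s \<Longrightarrow> m1 > 0 \<and> d > 0"
  using m_pos n_pos by (auto simp: zm_triple_def intro: Nat.gr0I)

text \<open>Raising \<open>j\<close> by \<open>n div d\<close> does not change
  \<open>b ^ (d * j)\<close>. One such shift multiplies the old value by \<open>r ^ n\<close>, which
  is 1 modulo \<open>m1\<close>, and adds a term that \<open>zm_triple\<close> makes 0.\<close>

lemma zm_triple_gsum_shift:
  assumes v: "zm_triple m1 d s"
  shows "[s * gsum r d (j + (n div d) * i) = s * gsum r d j] (mod int m1)"
proof (induction i)
  case (Suc i)
  let ?q = "n div d"
  have dq: "d * ?q = n" using v by (simp add: zm_triple_def)
  have "[int r ^ n = 1] (mod int m1)"
    using r_pow v by (meson cong_dvd_modulus int_dvd_int_iff zm_triple_def)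
  moreover have "[s * gsum r d ?q = 0] (mod int m1)"
    using v by (simp add: zm_triple_def cong_0_iff)
  ultimately have "[(s * gsum r d (j + ?q * i)) * int r ^ n + s * gsum r d ?q
      = (s * gsum r d j) * 1 + 0] (mod int m1)"
    by (intro cong_add cong_mult[OF Suc.IH])
  then show ?case
    using gsum_add[of r d "j + ?q * i" ?q] dq by (simp add: algebra_simps)
qed simp

text \<open>The definition asks for some representation of the element; invariance under shifts lets
  any representation decide membership.\<close>

lemma mem_zm_subgroup_iff:
  assumes v: "zm_triple m1 d s"
  shows "e (d * j) l \<in> zm_subgroup m1 d s \<longleftrightarrow> [l = s * gsum r d j] (mod int m1)"
proof
  assume "e (d * j) l \<in> zm_subgroup m1 d s"
  then obtain j' l' where *: "e (d * j) l = e (d * j') l'" "[l' = s * gsum r d j'] (mod int m1)"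
    by (auto simp: zm_subgroup_def)
  let ?q = "n div d"
  have n: "n = d * ?q" "d > 0" using v zm_triple_pos[OF v] by (simp_all add: zm_triple_def)
  have "[d * j = d * j'] (mod d * ?q)" using * n by (simp add: e_eq_iff)
  then have "[j = j'] (mod ?q)" using n(2) by (simp add: cong_def flip: mult_mod_right)
  then obtain k1 k2 where "j' + k1 * ?q = j + k2 * ?q" by (auto simp: cong_iff_lin_nat)
  then have "j' + ?q * k1 = j + ?q * k2" by (simp add: mult.commute)
  then have "[s * gsum r d j' = s * gsum r d j] (mod int m1)"
    using zm_triple_gsum_shift[OF v, of j' k1] zm_triple_gsum_shift[OF v, of j k2]
    by (metis cong_sym cong_trans)
  moreover have "[l = l'] (mod int m1)"
    using * v by (metis cong_dvd_modulus e_eq_iff int_dvd_int_iff zm_triple_def)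
  ultimately show "[l = s * gsum r d j] (mod int m1)" using * by (metis cong_trans)
qed (auto simp: zm_subgroup_def)

lemma mem_zm_subgroup_dvd:
  assumes v: "zm_triple m1 d s" and mem: "e k l \<in> zm_subgroup m1 d s"
  shows "d dvd k"
proof -
  obtain j l' where "e k l = e (d * j) l'" using mem by (auto simp: zm_subgroup_def)
  then have "[k = d * j] (mod d)" using v by (meson cong_dvd_modulus_nat e_eq_iff zm_triple_def)
  then show ?thesis by (simp add: cong_def mod_eq_0_iff_dvd)
qed

lemma mem_zm_subgroup_0_iff: "zm_triple m1 d s \<Longrightarrow> e 0 l \<in> zm_subgroup m1 d s \<longleftrightarrow> int m1 dvd l"
  using mem_zm_subgroup_iff[of m1 d s 0 l] by (simp add: cong_0_iff)

lemma gen_mem_zm_subgroup_iff: "zm_triple m1 d s \<Longrightarrow> e d l \<in> zm_subgroup m1 d s \<longleftrightarrow> [l = s] (mod int m1)"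
  using mem_zm_subgroup_iff[of m1 d s "Suc 0" l] by simp

lemma subgroup_zm_subgroup:
  assumes v: "zm_triple m1 d s"
  shows "subgroup (zm_subgroup m1 d s) G"
proof (rule subgroupI)
  show "zm_subgroup m1 d s \<subseteq> carrier G" by (auto simp: zm_subgroup_def)
  show "zm_subgroup m1 d s \<noteq> {}" using mem_zm_subgroup_0_iff[OF v, of 0] by auto
next
  fix x y assume "x \<in> zm_subgroup m1 d s" "y \<in> zm_subgroup m1 d s"
  then obtain i j a b where x: "x = e (d * i) a" "[a = s * gsum r d i] (mod int m1)"
    and y: "y = e (d * j) b" "[b = s * gsum r d j] (mod int m1)"
    unfolding zm_subgroup_def by blast
  have "x \<otimes> y = e (d * (i + j)) (a * int r ^ (d * j) + b)"
    by (simp add: x y e_mult algebra_simps)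
  moreover have "[a * int r ^ (d * j) + b = s * gsum r d i * int r ^ (d * j) + s * gsum r d j] (mod int m1)"
    using x y by (intro cong_add cong_mult) auto
  ultimately show "x \<otimes> y \<in> zm_subgroup m1 d s"
    using mem_zm_subgroup_iff[OF v, of "i + j" "a * int r ^ (d * j) + b"]
    by (simp add: gsum_add algebra_simps)
next
  fix x assume "x \<in> zm_subgroup m1 d s"
  then obtain j a where x: "x = e (d * j) a" "[a = s * gsum r d j] (mod int m1)"
    unfolding zm_subgroup_def by blast
  let ?q = "n div d"
  \<comment> \<open>\<open>i\<close> plays the role of \<open>- j\<close>: \<open>j + i\<close> is a
    multiple of \<open>n div d\<close>, and the exponents of \<open>b\<close> add up to
    \<open>n * j\<close>.\<close>
  define i where "i = j * (?q - 1)"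
  have n: "d * ?q = n" "?q > 0" using v n_pos
    by (auto simp: zm_triple_def dvd_div_eq_0_iff)
  have ij: "j + i = 0 + ?q * j" using n by (cases ?q) (simp_all add: i_def algebra_simps)
  have "d * j + d * i = n * j" using ij n by (metis add_0 distrib_left mult.assoc)
  then have "x \<otimes> e (d * i) (- a * int r ^ (d * i)) = \<one>"
    using e_mod_n[of 0 j 0] by (simp add: x e_mult e_0_0)
  then have inv: "inv x = e (d * i) (- a * int r ^ (d * i))"
    using inv_equality[of "e (d * i) (- a * int r ^ (d * i))" x] x
    by (metis e_closed inv_comm)
  have "[s * gsum r d (j + i) = 0] (mod int m1)"
    using zm_triple_gsum_shift[OF v, of 0 j] ij by simp
  then have "[s * gsum r d j * int r ^ (d * i) + s * gsum r d i = 0] (mod int m1)"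
    by (simp add: gsum_add[of r d j i] distrib_left mult.assoc)
  moreover have "[a * int r ^ (d * i) + s * gsum r d i
      = s * gsum r d j * int r ^ (d * i) + s * gsum r d i] (mod int m1)"
    by (intro cong_add cong_mult x cong_refl)
  ultimately have "[a * int r ^ (d * i) + s * gsum r d i = 0] (mod int m1)"
    by (rule cong_trans[rotated])
  then have "[0 = a * int r ^ (d * i) + s * gsum r d i] (mod int m1)"
    by (rule cong_sym)
  then have "[- a * int r ^ (d * i) + 0
      = - a * int r ^ (d * i) + (a * int r ^ (d * i) + s * gsum r d i)] (mod int m1)"
    by (intro cong_add cong_refl)
  then have "[- a * int r ^ (d * i) = s * gsum r d i] (mod int m1)" by simp
  then show "inv x \<in> zm_subgroup m1 d s" by (simp add: inv mem_zm_subgroup_iff[OF v])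
qed

lemma zm_subgroup_eqD:
  assumes v: "zm_triple m1 d s" "zm_triple m2 d' s'" and eq: "zm_subgroup m1 d s = zm_subgroup m2 d' s'"
  shows "m1 = m2 \<and> d = d' \<and> [s = s'] (mod int m1)"
proof (intro conjI)
  have "int m1 dvd l \<longleftrightarrow> int m2 dvd l" for l
    using mem_zm_subgroup_0_iff[OF v(1)] mem_zm_subgroup_0_iff[OF v(2)] eq by simp
  then show m: "m1 = m2" by (metis dvd_antisym dvd_refl int_dvd_int_iff)
  have "e d s \<in> zm_subgroup m1 d s" "e d' s' \<in> zm_subgroup m2 d' s'" using v by (simp_all add: gen_mem_zm_subgroup_iff)
  then show d: "d = d'" using mem_zm_subgroup_dvd v eq by (metis dvd_antisym)
  show "[s = s'] (mod int m1)"
    using \<open>e d s \<in> zm_subgroup m1 d s\<close> v eq m d by (simp add: gen_mem_zm_subgroup_iff)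
qed

lemma subgroup_eq_zm_subgroup:
  assumes H: "subgroup H G"
  obtains m1 d s where "zm_triple m1 d s" "0 \<le> s" "s < int m1" "H = zm_subgroup m1 d s"
proof -
  interpret H: subgroup H G by (rule H)
  have mult: "e (k + k') (l * int r ^ k' + l') \<in> H" if "e k l \<in> H" "e k' l' \<in> H" for k k' l l'
    using H.m_closed[OF that] by (simp add: e_mult)
  have one: "e 0 0 \<in> H" by (simp add: e_0_0)
  obtain m1 where m1: "m1 dvd m" "{l. e 0 l \<in> H} = {l. int m1 dvd l}"
  proof (rule add_closed_eq_multiples[OF m_pos, of "{l. e 0 l \<in> H}"])
    have "e 0 (int m) = e 0 0" by (simp add: e_eq_iff cong_def)
    then show "int m \<in> {l. e 0 l \<in> H}" using one by simp
    show "x + y \<in> {l. e 0 l \<in> H}" if "x \<in> {l. e 0 l \<in> H}" "y \<in> {l. e 0 l \<in> H}" for x y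
      using that mult[of 0 x 0 y] by simp
    show "y \<in> {l. e 0 l \<in> H}" if "x \<in> {l. e 0 l \<in> H}" "[x = y] (mod int m)" for x y
      using that e_eq_iff[of 0 x 0 y] by simp
  qed blast
  \<comment> \<open>The image of \<open>H\<close> modulo \<open><a>\<close>, recorded as all
    integers congruent to an exponent of \<open>b\<close> in \<open>H\<close>.\<close>
  let ?I = "{x. \<exists>k l. [int k = x] (mod int n) \<and> e k l \<in> H}"
  obtain d where d: "d dvd n" "?I = {x. int d dvd x}"
  proof (rule add_closed_eq_multiples[OF n_pos, of ?I])
    show "int n \<in> ?I" using one by (auto intro!: exI[of _ 0] simp: cong_def)
    show "x + y \<in> ?I" if xy: "x \<in> ?I" "y \<in> ?I" for x y
    proof -
      obtain k l k' l' where "[int k = x] (mod int n)" "e k l \<in> H"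
        "[int k' = y] (mod int n)" "e k' l' \<in> H" using xy by blast
      then have "[int (k + k') = x + y] (mod int n)" "e (k + k') (l * int r ^ k' + l') \<in> H"
        using mult by (auto intro: cong_add)
      then show ?thesis by blast
    qed
    show "y \<in> ?I" if "x \<in> ?I" "[x = y] (mod int n)" for x y
      using that by (blast intro: cong_trans)
  qed blast
  have "int d \<in> ?I" using d by simp
  then obtain k l0 where "[int k = int d] (mod int n)" "e k l0 \<in> H" by blast
  then have "e d l0 \<in> H" using e_eq_iff[of k l0 d l0] by (simp add: cong_int_iff)
  define s where "s = l0 mod int m1"
  have m1_pos: "m1 > 0" using m1 m_pos by (auto intro: Nat.gr0I)
  have "int m1 dvd s - l0" by (simp add: s_def flip: mod_eq_dvd_iff)
  then have "e 0 (s - l0) \<in> H" using m1 by blast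
  from mult[OF \<open>e d l0 \<in> H\<close> this] have eds: "e d s \<in> H" by simp
  have pow: "e (d * j) (s * gsum r d j) \<in> H" for j
  proof (induction j)
    case 0
    then show ?case using one by simp
  next
    case (Suc j)
    have "e (d + d * j) (s * int r ^ (d * j) + s * gsum r d j) \<in> H"
      by (rule mult[OF eds Suc])
    then show ?case by (simp add: gsum_Suc algebra_simps)
  qed
  have mem: "e (d * j) l \<in> H \<longleftrightarrow> [l = s * gsum r d j] (mod int m1)" for j l
  proof -
    \<comment> \<open>\<open>?x\<close> is a known element of \<open>H\<close> over
      \<open>b ^ (d * j)\<close>, so only the factor \<open>?y\<close> in \<open><a>\<close> has to
      be tested.\<close>
    let ?x = "e (d * j) (s * gsum r d j)" and ?y = "e 0 (l - s * gsum r d j)"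
    have "e (d * j) l = ?x \<otimes> ?y" by (simp add: e_mult)
    moreover have "?x \<otimes> ?y \<in> H \<longleftrightarrow> ?y \<in> H"
    proof
      assume "?x \<otimes> ?y \<in> H"
      then have "inv ?x \<otimes> (?x \<otimes> ?y) \<in> H" using pow by blast
      then show "?y \<in> H" by (simp add: m_assoc[symmetric])
    qed (use pow in blast)
    ultimately show ?thesis using m1 by (auto simp: cong_iff_dvd_diff)
  qed
  \<comment> \<open>This element is the identity; through \<open>mem\<close> it yields the last
    condition of \<open>zm_triple\<close>.\<close>
  have "e (d * (n div d)) 0 \<in> H"
    using d one e_mod_n[of 0 1 0] by simp
  then have "[s * gsum r d (n div d) = 0] (mod int m1)"
    unfolding mem by (rule cong_sym)
  then have "int m1 dvd s * gsum r d (n div d)" by (simp add: cong_0_iff)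
  then have v: "zm_triple m1 d s" using m1 d by (simp add: zm_triple_def)
  have "H = zm_subgroup m1 d s"
  proof (rule Set.set_eqI)
    fix x
    show "x \<in> H \<longleftrightarrow> x \<in> zm_subgroup m1 d s"
    proof
      assume x: "x \<in> H"
      then obtain k l where k: "x = e k l" using H.subset by (auto simp: carrier_eq)
      then have "int k \<in> ?I" using x by (intro CollectI exI[of _ k] exI[of _ l]) simp
      then have "d dvd k" unfolding d(2) by simp
      then obtain j where "k = d * j" by auto
      then show "x \<in> zm_subgroup m1 d s" using x k by (simp add: mem mem_zm_subgroup_iff[OF v])
    qed (auto simp: zm_subgroup_def mem)
  qed
  moreover have "0 \<le> s" "s < int m1" using m1_pos by (simp_all add: s_def)
  ultimately show ?thesis using that v by blast
qed


section \<open>Factorizations into two subgroups\<close>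

text \<open>The Chinese remainder theorem splits the exponent of \<open>b\<close> into multiples of
  \<open>n2\<close> and \<open>n3\<close>; Bezout's identity then corrects the exponent of
  \<open>a\<close> by multiples of \<open>m2\<close> and \<open>m3\<close>.\<close>

lemma zm_subgroup_mult_eq_carrier:
  assumes v: "zm_triple m2 n2 s" "zm_triple m3 n3 t" and cop: "coprime m2 m3" "coprime n2 n3"
  shows "zm_subgroup m2 n2 s <#> zm_subgroup m3 n3 t = carrier G"
proof
  show "zm_subgroup m2 n2 s <#> zm_subgroup m3 n3 t \<subseteq> carrier G"
    by (intro set_mult_closed) (auto simp: zm_subgroup_def)
  show "carrier G \<subseteq> zm_subgroup m2 n2 s <#> zm_subgroup m3 n3 t"
  proof
    fix g assume "g \<in> carrier G"
    then obtain k l where g: "g = e k l" by (auto simp: carrier_eq)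
    obtain x where x: "[x = 0] (mod n2)" "[x = k] (mod n3)"
      using binary_chinese_remainder_nat[OF cop(2)] by blast
    \<comment> \<open>\<open>y\<close> is \<open>k - x\<close> modulo \<open>n\<close>, written
      without subtraction.\<close>
    define y where "y = k + (n - 1) * x"
    have xy: "x + y = k + n * x" using n_pos by (cases n) (simp_all add: y_def)
    have "[y = x + (n - 1) * x] (mod n3)"
      unfolding y_def using x(2) by (intro cong_add cong_refl) (rule cong_sym)
    moreover have "x + (n - 1) * x = n * x" using n_pos by (cases n) simp_all
    moreover have "n3 dvd n * x" using v(2) by (simp add: zm_triple_def)
    ultimately have "n3 dvd y" by (metis cong_dvd_iff)
    then obtain j where j: "y = n3 * j" by auto
    have "n2 dvd x" using x by (simp add: cong_0_iff)
    then obtain i where i: "x = n2 * i" by auto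
    \<comment> \<open>Moving \<open>a\<close> past \<open>b ^ y\<close> multiplies its exponent by
      \<open>r ^ y\<close>, so Bezout's identity is needed for \<open>m2 * r ^ y\<close> and
      \<open>m3\<close>.\<close>
    have "coprime (int m2) (int m3)" using cop by simp
    moreover have "coprime (int r ^ y) (int m3)"
      using coprime_r v(2) by (meson coprime_divisors coprime_power_left_iff dvd_refl
          int_dvd_int_iff zm_triple_def)
    ultimately have "coprime (int m2 * int r ^ y) (int m3)" by simp
    then obtain u w where uw: "u * (int m2 * int r ^ y) + w * int m3 = 1"
      using bezout_int[of "int m2 * int r ^ y" "int m3"] by auto
    \<comment> \<open>\<open>c\<close> is what the exponent of \<open>a\<close> still lacks when
      both factors are powers of \<open>e n2 s\<close> and \<open>e n3 t\<close>.\<close>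
    define c where "c = l - s * gsum r n2 i * int r ^ y - t * gsum r n3 j"
    define a where "a = s * gsum r n2 i + int m2 * (u * c)"
    define b where "b = t * gsum r n3 j + int m3 * (w * c)"
    have "e x a \<in> zm_subgroup m2 n2 s" unfolding i mem_zm_subgroup_iff[OF v(1)] by (simp add: a_def cong_def)
    moreover have "e y b \<in> zm_subgroup m3 n3 t" unfolding j mem_zm_subgroup_iff[OF v(2)] by (simp add: b_def cong_def)
    moreover have "g = e x a \<otimes> e y b"
    proof -
      have "a * int r ^ y + b = s * gsum r n2 i * int r ^ y + t * gsum r n3 j
          + (u * (int m2 * int r ^ y) + w * int m3) * c"
        by (simp add: a_def b_def algebra_simps)
      also have "\<dots> = l" by (simp only: uw) (simp add: c_def)
      finally show ?thesis by (simp add: g e_mult xy e_mod_n)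
    qed
    ultimately show "g \<in> zm_subgroup m2 n2 s <#> zm_subgroup m3 n3 t" by (auto simp: set_mult_def)
  qed
qed

text \<open>
  Modulo \<open>p\<close> the subgroup lies in a conjugate of \<open><b>\<close>. If \<open>r ^ d\<close> is 1 modulo \<open>p\<close>, the geometric sum is
  \<open>n div d\<close>, invertible because \<open>m\<close> and \<open>n\<close> are coprime; otherwise \<open>r ^ d - 1\<close> is invertible.
\<close>

lemma zm_subgroup_mod_prime_coboundary:
  assumes v: "zm_triple m1 d s" and p: "prime p" "p dvd m1"
  obtains t where "\<And>k l. e k l \<in> zm_subgroup m1 d s \<Longrightarrow> [l = t * (int r ^ k - 1)] (mod int p)"
proof -
  have *: "\<exists>j. k = d * j \<and> [l = s * gsum r d j] (mod int p)" if mem: "e k l \<in> zm_subgroup m1 d s" for k l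
  proof -
    obtain j where j: "k = d * j" using mem_zm_subgroup_dvd[OF v mem] by auto
    then have "[l = s * gsum r d j] (mod int m1)" using mem mem_zm_subgroup_iff[OF v] by simp
    moreover have "int p dvd int m1" using p(2) by simp
    ultimately have "[l = s * gsum r d j] (mod int p)" by (rule cong_dvd_modulus)
    then show ?thesis using j by blast
  qed
  have p': "prime (int p)" using p by simp
  show ?thesis
  proof (cases "[int r ^ d = 1] (mod int p)")
    case True
    have "[(int r ^ d) ^ i = 1] (mod int p)" for i using cong_pow[OF True, of i] by simp
    then have "[gsum r d j = (\<Sum>i<j. 1)] (mod int p)" for j
      unfolding gsum_def by (intro cong_sum) (simp add: power_mult)
    then have "[gsum r d (n div d) = int (n div d)] (mod int p)" by (metis sum_constant card_lessThan mult.right_neutral)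
    moreover have "\<not> int p dvd int (n div d)"
    proof
      assume "int p dvd int (n div d)"
      then have "p dvd n" using v by (metis div_dvd_iff_mult dvd_mult_div_cancel dvd_trans dvd_triv_right int_dvd_int_iff zm_triple_def)
      moreover have "p dvd m" using p v by (auto simp: zm_triple_def)
      ultimately show False using coprime_mn p by (metis coprime_common_divisor not_prime_unit)
    qed
    ultimately have "\<not> int p dvd gsum r d (n div d)" by (simp add: cong_dvd_iff)
    moreover have "int p dvd s * gsum r d (n div d)"
      using v p by (meson dvd_trans int_dvd_int_iff zm_triple_def)
    ultimately have s: "int p dvd s" using p' by (simp add: prime_dvd_mult_iff)
    have "[l = 0 * (int r ^ k - 1)] (mod int p)" if mem: "e k l \<in> zm_subgroup m1 d s" for k l
    proof -
      obtain j where "[l = s * gsum r d j] (mod int p)" using *[OF mem] by blast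
      moreover have "[s * gsum r d j = 0] (mod int p)" using s by (simp add: cong_0_iff)
      ultimately show ?thesis by (simp add: cong_trans)
    qed
    then show ?thesis using that by blast
  next
    case False
    then have "coprime (int r ^ d - 1) (int p)"
      using p' by (simp add: cong_iff_dvd_diff prime_imp_coprime coprime_commute)
    then obtain u where u: "[(int r ^ d - 1) * u = 1] (mod int p)"
      using cong_solve_coprime_int by blast
    \<comment> \<open>As \<open>u\<close> inverts \<open>r ^ d - 1\<close>, the geometric sum is
      \<open>u * (r ^ k - 1)\<close> modulo \<open>p\<close>. With \<open>t = s * u\<close>, the
      result is the exponent of \<open>a\<close> in
      \<open>a ^ t * b ^ k * a ^ (- t)\<close>.\<close>
    have "[l = (s * u) * (int r ^ k - 1)] (mod int p)" if mem: "e k l \<in> zm_subgroup m1 d s" for k l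
    proof -
      obtain j where j: "k = d * j" "[l = s * gsum r d j] (mod int p)" using *[OF mem] by blast
      have "[(s * gsum r d j) * ((int r ^ d - 1) * u) = (s * gsum r d j) * 1] (mod int p)"
        by (intro cong_mult u cong_refl)
      moreover have "(s * gsum r d j) * ((int r ^ d - 1) * u) = (s * u) * (int r ^ k - 1)"
        unfolding j(1) gsum_mult[of r d j, symmetric] by (simp add: algebra_simps)
      ultimately show ?thesis using j(2) by (metis cong_sym cong_trans mult.right_neutral)
    qed
    then show ?thesis using that by blast
  qed
qed

text \<open>A common divisor of \<open>n2\<close> and \<open>n3\<close> divides the exponent of
  \<open>b\<close> in every product, so factoring \<open>b\<close> itself makes it 1. A common prime
  of \<open>m2\<close> and \<open>m3\<close> is refuted by a power of \<open>a\<close> that has no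
  factorization.\<close>

lemma zm_subgroup_mult_eq_carrierD:
  assumes v: "zm_triple m2 n2 s" "zm_triple m3 n3 t" and eq: "zm_subgroup m2 n2 s <#> zm_subgroup m3 n3 t = carrier G"
  shows "coprime m2 m3 \<and> coprime n2 n3"
proof (rule conjI)
  have factor: "\<exists>x a y b. e x a \<in> zm_subgroup m2 n2 s \<and> e y b \<in> zm_subgroup m3 n3 t \<and>
      [k = x + y] (mod n) \<and> [l = a * int r ^ y + b] (mod int m)" for k l
  proof -
    have "e k l \<in> zm_subgroup m2 n2 s <#> zm_subgroup m3 n3 t" unfolding eq by simp
    then obtain h h' where h: "h \<in> zm_subgroup m2 n2 s" "h' \<in> zm_subgroup m3 n3 t" "e k l = h \<otimes> h'"
      by (auto simp: set_mult_def)
    then have "h \<in> carrier G" "h' \<in> carrier G"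
      using v subgroup_zm_subgroup subgroup.mem_carrier by metis+
    then obtain x a y b where "h = e x a" "h' = e y b" by (auto simp: carrier_eq)
    then show ?thesis using h by (auto simp: e_mult e_eq_iff)
  qed
  show "coprime n2 n3"
  proof (rule coprimeI)
    fix c assume c: "c dvd n2" "c dvd n3"
    obtain x a y b where xy: "e x a \<in> zm_subgroup m2 n2 s" "e y b \<in> zm_subgroup m3 n3 t" "[1 = x + y] (mod n)"
      using factor[of 1 0] by blast
    then have "c dvd x + y" using v c by (meson dvd_add dvd_trans mem_zm_subgroup_dvd)
    moreover have "c dvd n" using c v by (auto simp: zm_triple_def)
    ultimately show "is_unit c" using xy(3) by (meson cong_dvd_iff cong_dvd_modulus_nat)
  qed
  show "coprime m2 m3"
  proof (rule ccontr)
    assume "\<not> coprime m2 m3"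
    then obtain p where p: "prime p" "p dvd m2" "p dvd m3"
      by (metis coprime_iff_gcd_eq_1 gcd_greatest_iff prime_factor_nat)
    have pm: "int p dvd int m" using p v by (auto simp: zm_triple_def)
    obtain u where u: "\<And>k l. e k l \<in> zm_subgroup m2 n2 s \<Longrightarrow> [l = u * (int r ^ k - 1)] (mod int p)"
      using zm_subgroup_mod_prime_coboundary[OF v(1) p(1,2)] by blast
    obtain w where w: "\<And>k l. e k l \<in> zm_subgroup m3 n3 t \<Longrightarrow> [l = w * (int r ^ k - 1)] (mod int p)"
      using zm_subgroup_mod_prime_coboundary[OF v(2) p(1,3)] by blast
    \<comment> \<open>the exponent of \<open>a\<close> in a product lying over the identity is \<open>(w - u) * (r ^ y - 1)\<close>
      modulo \<open>p\<close>; this never equals \<open>c\<close>, because \<open>r ^ y\<close> is not 0\<close>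
    define c where "c = (if [w = u] (mod int p) then 1 else u - w)"
    obtain x a y b where xy: "e x a \<in> zm_subgroup m2 n2 s" "e y b \<in> zm_subgroup m3 n3 t" "[0 = x + y] (mod n)"
      "[c = a * int r ^ y + b] (mod int m)" using factor[of 0 c] by blast
    \<comment> \<open>\<open>r ^ x\<close> and \<open>r ^ y\<close> are inverse modulo
      \<open>p\<close>, which eliminates \<open>x\<close> below.\<close>
    have "[int r ^ (x + y) = 1] (mod int p)"
    proof -
      have "n dvd x + y" using xy(3) by (meson cong_0_iff cong_sym)
      then show ?thesis using r_pow_mult pm by (metis cong_dvd_modulus dvdE)
    qed
    have "[c = a * int r ^ y + b] (mod int p)" using xy(4) pm by (rule cong_dvd_modulus)
    moreover have "[a * int r ^ y + b
        = u * (int r ^ x - 1) * int r ^ y + w * (int r ^ y - 1)] (mod int p)"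
      using u[OF xy(1)] w[OF xy(2)] by (intro cong_add cong_mult cong_refl)
    moreover have "u * (int r ^ x - 1) * int r ^ y + w * (int r ^ y - 1)
        = u * int r ^ (x + y) + (w - u) * int r ^ y - w"
      by (simp add: algebra_simps power_add)
    moreover have "[u * int r ^ (x + y) + (w - u) * int r ^ y - w
        = u * 1 + (w - u) * int r ^ y - w] (mod int p)"
      by (intro cong_add cong_diff cong_mult \<open>[int r ^ (x + y) = 1] (mod int p)\<close> cong_refl)
    ultimately have "[c = u * 1 + (w - u) * int r ^ y - w] (mod int p)"
      by (metis cong_trans)
    then have c: "int p dvd c - (u - w) - (w - u) * int r ^ y"
      by (simp add: cong_iff_dvd_diff algebra_simps)
    show False
    proof (cases "[w = u] (mod int p)")
      case True
      then have d: "int p dvd w - u" by (simp add: cong_iff_dvd_diff)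
      have "1 = (c - (u - w) - (w - u) * int r ^ y) - (w - u) + (w - u) * int r ^ y"
        using True by (simp add: c_def)
      then have "int p dvd 1" using c d by (metis dvd_add dvd_diff dvd_mult2)
      then show False using p(1) by auto
    next
      case False
      \<comment> \<open>The choice \<open>c = u - w\<close> cancels the constant terms; since
        \<open>p\<close> does not divide \<open>w - u\<close>, it would divide
        \<open>r\<close>.\<close>
      have "int p dvd (w - u) * int r ^ y"
        using c False by (simp add: c_def)
      moreover have "\<not> int p dvd w - u" using False by (simp add: cong_iff_dvd_diff)
      ultimately have "int p dvd int r"
        using p(1) by (metis prime_dvd_mult_iff prime_dvd_power prime_nat_int_transfer)
      then show False using coprime_r pm p(1)
        by (metis coprime_common_divisor not_prime_unit prime_nat_int_transfer)
    qed
  qed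
qed

section \<open>Counting the factorizations\<close>

lemma factorization_number_eq:
  "int (factorization_number G) =
     (\<Sum>(m2, m3, n2, n3) \<in> {(m2, m3, n2, n3).
           m2 dvd m \<and> m3 dvd m \<and> n2 dvd n \<and> n3 dvd n \<and> gcd m2 m3 = 1 \<and> gcd n2 n3 = 1}.
        gcd (int m2) (gsum r n2 (n div n2)) * gcd (int m3) (gsum r n3 (n div n3)))"
proof -
  define Q where "Q = {(m2, m3, n2, n3).
    m2 dvd m \<and> m3 dvd m \<and> n2 dvd n \<and> n3 dvd n \<and> gcd m2 m3 = 1 \<and> gcd n2 n3 = 1}"
  \<comment> \<open>\<open>T m1 d\<close> holds one \<open>s\<close> from each admissible class
    modulo \<open>m1\<close>, so that \<open>f\<close> is injective on \<open>P\<close>.\<close>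
  define T where "T m1 d = {s::int. 0 \<le> s \<and> s < int m1 \<and> int m1 dvd s * gsum r d (n div d)}" for m1 d
  define P where "P = (SIGMA q : Q. case q of (m2, m3, n2, n3) \<Rightarrow> T m2 n2 \<times> T m3 n3)"
  define f where "f = (\<lambda>((m2, m3, n2, n3), (s, t)). (zm_subgroup m2 n2 s, zm_subgroup m3 n3 t))"
  have zm_tripleI: "zm_triple m1 d s" if "m1 dvd m" "d dvd n" "s \<in> T m1 d" for m1 d s
    using that by (simp add: zm_triple_def T_def)
  have uniq: "m1 = m1' \<and> d = d' \<and> s = s'"
    if "m1 dvd m" "d dvd n" "s \<in> T m1 d" "m1' dvd m" "d' dvd n" "s' \<in> T m1' d'"
      "zm_subgroup m1 d s = zm_subgroup m1' d' s'" for m1 d s m1' d' s'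
    using zm_subgroup_eqD[OF zm_tripleI[OF that(1-3)] zm_tripleI[OF that(4-6)] that(7)] that(3,6)
    by (auto simp: T_def cong_def)
  have inj: "inj_on f P"
  proof (rule inj_onI)
    fix a b assume "a \<in> P" "b \<in> P" "f a = f b"
    then show "a = b" unfolding P_def f_def Q_def by (auto dest: uniq)
  qed
  have img: "f ` P = {(H, K). H \<in> subgroup_set G \<and> K \<in> subgroup_set G \<and> H <#> K = carrier G}"
  proof (intro equalityI subsetI)
    fix x assume "x \<in> f ` P"
    then obtain m2 m3 n2 n3 s t where q: "(m2, m3, n2, n3) \<in> Q" "s \<in> T m2 n2" "t \<in> T m3 n3"
      and x: "x = (zm_subgroup m2 n2 s, zm_subgroup m3 n3 t)" by (auto simp: f_def P_def)
    then have v: "zm_triple m2 n2 s" "zm_triple m3 n3 t" by (auto simp: Q_def intro: zm_tripleI)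
    then show "x \<in> {(H, K). H \<in> subgroup_set G \<and> K \<in> subgroup_set G \<and> H <#> K = carrier G}"
      using q zm_subgroup_mult_eq_carrier[OF v] subgroup_zm_subgroup
      by (simp add: x subgroup_set_def Q_def coprime_iff_gcd_eq_1)
  next
    fix x assume "x \<in> {(H, K). H \<in> subgroup_set G \<and> K \<in> subgroup_set G \<and> H <#> K = carrier G}"
    then obtain H K where x: "x = (H, K)" "subgroup H G" "subgroup K G" "H <#> K = carrier G"
      by (auto simp: subgroup_set_def)
    obtain m2 n2 s where H: "zm_triple m2 n2 s" "0 \<le> s" "s < int m2" "H = zm_subgroup m2 n2 s"
      using subgroup_eq_zm_subgroup[OF x(2)] by blast
    obtain m3 n3 t where K: "zm_triple m3 n3 t" "0 \<le> t" "t < int m3" "K = zm_subgroup m3 n3 t"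
      using subgroup_eq_zm_subgroup[OF x(3)] by blast
    have "coprime m2 m3 \<and> coprime n2 n3"
      using zm_subgroup_mult_eq_carrierD[OF H(1) K(1)] x(4) H(4) K(4) by simp
    then have "((m2, m3, n2, n3), (s, t)) \<in> P"
      using H K by (simp add: P_def Q_def T_def zm_triple_def coprime_iff_gcd_eq_1)
    moreover have "x = f ((m2, m3, n2, n3), (s, t))" by (simp add: f_def x H K)
    ultimately show "x \<in> f ` P" by blast
  qed
  have finT: "finite (T m1 d)" for m1 d
    by (rule finite_subset[of _ "{0..<int m1}"]) (auto simp: T_def)
  have "Q \<subseteq> {0..m} \<times> {0..m} \<times> {0..n} \<times> {0..n}"
    using m_pos n_pos by (auto simp: Q_def intro: dvd_imp_le)
  then have finQ: "finite Q" by (rule finite_subset) simp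
  have cardT: "int (card (T m1 d)) = gcd (int m1) (gsum r d (n div d))" if "m1 dvd m" for m1 d
    unfolding T_def using that m_pos by (intro card_solutions_dvd) (auto intro: Suc_leI Nat.gr0I)
  have "factorization_number G = card P"
    unfolding factorization_number_def img[symmetric] by (rule card_image[OF inj])
  also have "\<dots> = (\<Sum>q\<in>Q. case q of (m2, m3, n2, n3) \<Rightarrow> card (T m2 n2) * card (T m3 n3))"
    unfolding P_def using finQ finT
    by (subst card_SigmaI) (auto simp: card_cartesian_product intro!: sum.cong)
  finally have "int (factorization_number G) =
      (\<Sum>q\<in>Q. case q of (m2, m3, n2, n3) \<Rightarrow> int (card (T m2 n2)) * int (card (T m3 n3)))"
    by (simp add: case_prod_unfold)
  also have "\<dots> = (\<Sum>(m2, m3, n2, n3)\<in>Q.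
      gcd (int m2) (gsum r n2 (n div n2)) * gcd (int m3) (gsum r n3 (n div n3)))"
    by (rule sum.cong) (auto simp: Q_def cardT)
  finally show ?thesis by (simp add: Q_def)
qed

end


section \<open>Normal forms in the presented group\<close>

text \<open>Conjugation by \<open>B\<close> is a homomorphism sending \<open>A\<close> to
  \<open>A [^] r\<close>, so each factor \<open>B\<close> that is passed multiplies the exponent of
  \<open>A\<close> by \<open>r\<close>.\<close>

lemma (in group) int_pow_nat_pow_commute:
  assumes A: "A \<in> carrier G" and B: "B \<in> carrier G"
    and AB: "inv B \<otimes> A \<otimes> B = A [^] (r::nat)"
  shows "A [^] (l::int) \<otimes> B [^] (k::nat) = B [^] k \<otimes> A [^] (l * int r ^ k)"
proof -
  have cancel: "B \<otimes> (inv B \<otimes> x) = x" if "x \<in> carrier G" for x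
    using B that by (simp flip: m_assoc)
  have hom: "(\<lambda>x. inv B \<otimes> x \<otimes> B) \<in> hom G G"
    using B by (auto simp: hom_def m_assoc cancel)
  have step: "A [^] (l::int) \<otimes> B = B \<otimes> A [^] (l * int r)" for l
  proof -
    have "inv B \<otimes> A [^] l \<otimes> B = (A [^] r) [^] l"
      using hom_int_pow[OF hom A group_axioms group_axioms, of l] AB by simp
    also have "\<dots> = A [^] (l * int r)"
      using A by (simp add: int_pow_pow mult.commute flip: int_pow_int)
    finally have "B \<otimes> (inv B \<otimes> (A [^] l \<otimes> B)) = B \<otimes> A [^] (l * int r)"
      using A B by (simp add: m_assoc)
    then show ?thesis using A B by (simp add: cancel)
  qed
  show ?thesis
  proof (induction k)
    case (Suc k)
    have "A [^] l \<otimes> B [^] Suc k = B [^] k \<otimes> A [^] (l * int r ^ k) \<otimes> B"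
      using A B by (simp add: Suc flip: m_assoc)
    also have "\<dots> = B [^] Suc k \<otimes> A [^] (l * int r ^ Suc k)"
      using A B step[of "l * int r ^ k"] by (simp add: m_assoc mult.commute mult.left_commute)
    finally show ?case .
  qed (use A in simp)
qed

lemma (in group) nat_pow_cong:
  assumes "x \<in> carrier G" "x [^] (n::nat) = \<one>" "[k = k'] (mod n)"
  shows "x [^] k = x [^] k'"
proof -
  have *: "x [^] (j + i * n) = x [^] j" for i j
    using assms by (simp add: mult.commute[of i] flip: nat_pow_mult nat_pow_pow)
  obtain i j where "k' + i * n = k + j * n" using assms(3) by (auto simp: cong_iff_lin_nat)
  then show ?thesis using * by metis
qed

lemma (in group) int_pow_cong:
  assumes "x \<in> carrier G" "x [^] (m::nat) = \<one>" "[l = l'] (mod int m)"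
  shows "x [^] l = x [^] l'"
proof -
  obtain q where "l' = l + int m * q" using assms(3) by (auto simp: cong_iff_lin)
  then show ?thesis
    using assms by (simp add: int_pow_mult int_pow_int flip: int_pow_pow)
qed

text \<open>
  Uniqueness of the normal form comes from evaluating words in a monoid on pairs of exponents
  and checking that the relations preserve the residues. The inverse of \<open>b\<close> is evaluated as
  \<open>n - 1\<close>, so that the exponents of \<open>r\<close> remain natural numbers.
\<close>

fun twisted_mult :: "nat \<Rightarrow> nat \<times> int \<Rightarrow> nat \<times> int \<Rightarrow> nat \<times> int" where
  "twisted_mult r (k, l) (k', l') = (k + k', l * int r ^ k' + l')"

fun letter_val :: "nat \<Rightarrow> zm_gen \<times> bool \<Rightarrow> nat \<times> int" where
  "letter_val n (Gen_a, s) = (0, if s then 1 else - 1)"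
| "letter_val n (Gen_b, s) = (if s then 1 else n - 1, 0)"

fun word_val :: "nat \<Rightarrow> nat \<Rightarrow> zm_gen gword \<Rightarrow> nat \<times> int" where
  "word_val n r [] = (0, 0)"
| "word_val n r (x # u) = twisted_mult r (letter_val n x) (word_val n r u)"

definition val_cong :: "nat \<Rightarrow> nat \<Rightarrow> nat \<times> int \<Rightarrow> nat \<times> int \<Rightarrow> bool" where
  "val_cong m n x y \<longleftrightarrow> [fst x = fst y] (mod n) \<and> [snd x = snd y] (mod int m)"

lemma twisted_mult_assoc:
  "twisted_mult r (twisted_mult r x y) z = twisted_mult r x (twisted_mult r y z)"
  by (cases x; cases y; cases z) (simp add: algebra_simps power_add)

lemma twisted_mult_0 [simp]: "twisted_mult r (0, 0) x = x"
  by (cases x) simp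

lemma word_val_append: "word_val n r (u @ v) = twisted_mult r (word_val n r u) (word_val n r v)"
  by (induction u) (simp_all add: twisted_mult_assoc)

lemma word_val_replicate_a: "word_val n r (replicate j (Gen_a, True)) = (0, int j)"
  and word_val_replicate_b: "word_val n r (replicate j (Gen_b, True)) = (j, 0)"
  by (induction j) auto

text \<open>Since \<open>r ^ n\<close> is 1 modulo \<open>m\<close>, \<open>r ^ k\<close> depends
  modulo \<open>m\<close> only on \<open>k\<close> modulo \<open>n\<close>, and the twisted product
  descends to residues.\<close>

lemma val_cong_mult:
  assumes r: "[int r ^ n = 1] (mod int m)" and x: "val_cong m n x x'" and y: "val_cong m n y y'"
  shows "val_cong m n (twisted_mult r x y) (twisted_mult r x' y')"
proof -
  obtain k l k' l' where xy: "y = (k, l)" "y' = (k', l')" by (cases y, cases y') auto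
  have mult: "[int r ^ (j + i * n) = int r ^ j] (mod int m)" for i j
    using cong_mult[OF cong_refl cong_pow[OF r, of i], of "int r ^ j"]
    by (simp add: power_add mult.commute[of i] flip: power_mult)
  have "[k = k'] (mod n)" using y xy by (simp add: val_cong_def)
  then obtain i j where "k' + i * n = k + j * n" by (auto simp: cong_iff_lin_nat)
  then have "[int r ^ k = int r ^ k'] (mod int m)"
    using mult by (metis cong_sym cong_trans)
  then show ?thesis
    using x y xy by (cases x, cases x') (auto simp: val_cong_def intro!: cong_add cong_mult)
qed

lemma pres_eq_imp_val_cong:
  assumes n: "n \<ge> 1" and r: "[int r ^ n = 1] (mod int m)"
  shows "pres_eq (zm_relations m n r) u v \<Longrightarrow> val_cong m n (word_val n r u) (word_val n r v)"
proof (induction rule: pres_eq.induct)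
  case (cancel p x s q)
  \<comment> \<open>A letter \<open>b\<close> next to its inverse evaluates to
    \<open>(n, 0)\<close>, congruent but not equal to \<open>(0, 0)\<close>.\<close>
  have "val_cong m n (word_val n r [(x, s), (x, \<not> s)]) (0, 0)"
    using n by (cases x) (auto simp: val_cong_def cong_0_iff)
  then show ?case
    unfolding word_val_append
    using val_cong_mult[OF r, of "word_val n r [(x, s), (x, \<not> s)]" "(0, 0)" "word_val n r q" "word_val n r q"]
    by (intro val_cong_mult[OF r]) (simp_all add: val_cong_def)
next
  case (relation u v p q)
  have "val_cong m n (word_val n r u) (word_val n r v)"
    using relation n
    by (auto simp: zm_relations_def val_cong_def word_val_replicate_a word_val_replicate_b cong_0_iff)
  then show ?case
    unfolding word_val_append
    by (intro val_cong_mult[OF r]) (simp_all add: val_cong_def)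
qed (auto simp: val_cong_def intro: cong_sym cong_trans)

text \<open>The relations show that the elements \<open>e k l\<close> exhaust the group and depend
  only on residues; evaluating words shows that different residues give different elements.\<close>

lemma zm_group_ZM:
  assumes m: "m \<ge> 1" and n: "n \<ge> 1" and cop: "coprime m n"
    and r: "[int r ^ n = 1] (mod int m)"
  obtains e where "zm_group (ZM m n r) e m n r"
proof -
  define R where "R = zm_relations m n r"
  define G where "G = presented_group R"
  define cl where "cl u = pres_rel R `` {u}" for u
  interpret G: group G unfolding G_def by (rule group_presented_group)
  have cl_eq: "cl u = cl v \<longleftrightarrow> pres_eq R u v" for u v
    using eq_equiv_class_iff[OF equiv_pres_rel, of u v R] by (simp add: cl_def pres_rel_def)
  have cl_closed [simp]: "cl u \<in> carrier G" for u by (simp add: cl_def G_def)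
  have cl_append: "cl (u @ v) = cl u \<otimes>\<^bsub>G\<^esub> cl v" for u v
    by (simp add: cl_def G_def presented_group_mult)
  have cl_Nil: "cl [] = \<one>\<^bsub>G\<^esub>" by (simp add: cl_def G_def presented_group_def)
  have cl_replicate: "cl (replicate j x) = cl [x] [^]\<^bsub>G\<^esub> j" for j x
    by (induction j) (simp_all add: cl_Nil cl_append replicate_append_same[symmetric])
  have cl_rel: "cl u = cl v" if "(u, v) \<in> R" for u v
    using pres_eq.relation[OF that, of "[]" "[]"] by (simp add: cl_eq)
  have cl_inv: "cl [(x, False)] = inv\<^bsub>G\<^esub> cl [(x, True)]" for x
  proof -
    have "cl ([(x, False)] @ [(x, True)]) = cl []"
      using pres_eq.cancel[of R "[]" x False "[]"] by (simp add: cl_eq)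
    then show ?thesis by (simp add: cl_append cl_Nil G.inv_equality del: append.simps)
  qed
  define A where "A = cl [(Gen_a, True)]"
  define B where "B = cl [(Gen_b, True)]"
  have AB [simp]: "A \<in> carrier G" "B \<in> carrier G" by (simp_all add: A_def B_def)
  have A_m: "A [^]\<^bsub>G\<^esub> m = \<one>\<^bsub>G\<^esub>" and B_n: "B [^]\<^bsub>G\<^esub> n = \<one>\<^bsub>G\<^esub>"
    unfolding A_def B_def cl_Nil[symmetric] cl_replicate[symmetric]
    by (rule cl_rel; simp add: R_def zm_relations_def)+
  have "cl ([(Gen_b, False)] @ [(Gen_a, True)] @ [(Gen_b, True)]) = cl (replicate r (Gen_a, True))"
    by (rule cl_rel) (simp add: R_def zm_relations_def)
  then have conj: "inv\<^bsub>G\<^esub> B \<otimes>\<^bsub>G\<^esub> A \<otimes>\<^bsub>G\<^esub> B = A [^]\<^bsub>G\<^esub> r"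
    by (simp only: cl_append cl_replicate cl_inv A_def B_def) (simp add: G.m_assoc)
  define e where "e k l = B [^]\<^bsub>G\<^esub> k \<otimes>\<^bsub>G\<^esub> A [^]\<^bsub>G\<^esub> l" for k :: nat and l :: int
  have e_mult: "e k l \<otimes>\<^bsub>G\<^esub> e k' l' = e (k + k') (l * int r ^ k' + l')" for k l k' l'
  proof -
    have "e k l \<otimes>\<^bsub>G\<^esub> e k' l' =
        B [^]\<^bsub>G\<^esub> k \<otimes>\<^bsub>G\<^esub> (A [^]\<^bsub>G\<^esub> l \<otimes>\<^bsub>G\<^esub> B [^]\<^bsub>G\<^esub> k') \<otimes>\<^bsub>G\<^esub> A [^]\<^bsub>G\<^esub> l'"
      by (simp add: e_def G.m_assoc)
    then show ?thesis
      unfolding G.int_pow_nat_pow_commute[OF AB conj]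
      by (simp add: e_def G.m_assoc G.int_pow_mult flip: G.nat_pow_mult)
  qed
  have e_cong: "e k l = e k' l'" if "[k = k'] (mod n)" "[l = l'] (mod int m)" for k l k' l'
    using G.nat_pow_cong[OF AB(2) B_n that(1)] G.int_pow_cong[OF AB(1) A_m that(2)]
    by (simp add: e_def)
  have "inv\<^bsub>G\<^esub> B = B [^]\<^bsub>G\<^esub> (n - 1)"
    using B_n n by (intro G.inv_equality) (cases n; simp)+
  then have letter: "cl [x] = e (fst (letter_val n x)) (snd (letter_val n x))" for x
    by (cases "(n, x)" rule: letter_val.cases)
       (auto simp: e_def cl_inv G.int_pow_neg simp flip: A_def B_def)
  have cl_val: "cl u = e (fst (word_val n r u)) (snd (word_val n r u))" for u
  proof (induction u)
    case Nil
    show ?case by (simp add: cl_Nil e_def)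
  next
    case (Cons x u)
    have "cl (x # u) = cl [x] \<otimes>\<^bsub>G\<^esub> cl u" using cl_append[of "[x]" u] by simp
    then show ?case
      unfolding letter Cons e_mult by (cases "letter_val n x"; cases "word_val n r u") simp
  qed
  \<comment> \<open>An explicit word for \<open>e k l\<close>: equality in the group becomes
    equivalence of words, which evaluation can test. Reducing \<open>l\<close> makes the exponent
    natural.\<close>
  define W where "W k l = replicate k (Gen_b, True) @ replicate (nat (l mod int m)) (Gen_a, True)" for k l
  have val_W: "word_val n r (W k l) = (k, l mod int m)" for k l
    using m by (simp add: W_def word_val_append word_val_replicate_a word_val_replicate_b)
  have e_W: "e k l = cl (W k l)" for k l
    unfolding cl_val val_W by (rule e_cong) (simp_all add: cong_def)
  have e_eq: "[k = k'] (mod n) \<and> [l = l'] (mod int m)" if "e k l = e k' l'" for k l k' l'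
  proof -
    have "pres_eq R (W k l) (W k' l')" using that by (simp add: e_W cl_eq)
    then have "val_cong m n (word_val n r (W k l)) (word_val n r (W k' l'))"
      unfolding R_def by (rule pres_eq_imp_val_cong[OF n r])
    then show ?thesis by (simp add: val_W val_cong_def cong_def)
  qed
  have carrier: "carrier G = {e k l | k l. True}"
  proof (intro equalityI subsetI)
    fix x assume "x \<in> carrier G"
    then obtain u where "x = cl u" unfolding G_def cl_def by (rule presented_group_carrierE)
    then show "x \<in> {e k l | k l. True}" using cl_val by blast
  qed (auto simp: e_def)
  have "e k l = e k' l' \<longleftrightarrow> [k = k'] (mod n) \<and> [l = l'] (mod int m)" for k l k' l'
    using e_eq[of k l k' l'] e_cong[of k k' l l'] by blast
  then have "zm_group G e m n r"
    by (intro zm_group.intro zm_group_axioms.intro G.group_axioms m n cop r carrier e_mult)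
  then show ?thesis using that by (simp add: G_def R_def ZM_def)
qed

section \<open>The formula and the group of order 36\<close>

theorem theorem3p1:
  "(\<forall>m n r :: nat.
      m \<ge> 1 \<longrightarrow> n \<ge> 1 \<longrightarrow> gcd m n = 1 \<longrightarrow> gcd (int m) (int r - 1) = 1 \<longrightarrow> [r ^ n = 1] (mod m) \<longrightarrow>
      int (factorization_number (ZM m n r)) =
        (\<Sum>(m2, m3, n2, n3) \<in> {(m2, m3, n2, n3).
              m2 dvd m \<and> m3 dvd m \<and> n2 dvd n \<and> n3 dvd n \<and> gcd m2 m3 = 1 \<and> gcd n2 n3 = 1}.
           gcd (int m2) (zm_quotient r n n2) * gcd (int m3) (zm_quotient r n n3)))
   \<and> factorization_number (ZM 9 4 8) = 85"
proof -
  have formula: "int (factorization_number (ZM m n r)) =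
      (\<Sum>(m2, m3, n2, n3) \<in> {(m2, m3, n2, n3).
          m2 dvd m \<and> m3 dvd m \<and> n2 dvd n \<and> n3 dvd n \<and> gcd m2 m3 = 1 \<and> gcd n2 n3 = 1}.
        gcd (int m2) (zm_quotient r n n2) * gcd (int m3) (zm_quotient r n n3))"
    if hyps: "m \<ge> 1" "n \<ge> 1" "gcd m n = 1" "[r ^ n = 1] (mod m)" for m n r
  proof -
    have "[int r ^ n = 1] (mod int m)"
      using hyps(4) by (metis cong_int_iff of_nat_1 of_nat_power)
    then obtain e where "zm_group (ZM m n r) e m n r"
      using zm_group_ZM[OF hyps(1,2)] hyps(3) by (auto simp: coprime_iff_gcd_eq_1)
    from zm_group.factorization_number_eq[OF this] show ?thesis
      using hyps(2) by (auto simp: zm_quotient_eq_gsum intro!: sum.cong)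
  qed
  have dvd_9: "k \<in> {1, 3, 9}" if "k dvd 9" for k :: nat
  proof -
    have "k \<in> {..9}" using that by (auto dest: dvd_imp_le)
    also have "{..9::nat} = {0, 1, 2, 3, 4, 5, 6, 7, 8, 9}" by auto
    finally show ?thesis using that by auto
  qed
  have dvd_4: "k \<in> {1, 2, 4}" if "k dvd 4" for k :: nat
  proof -
    have "k \<in> {..4}" using that by (auto dest: dvd_imp_le)
    also have "{..4::nat} = {0, 1, 2, 3, 4}" by auto
    finally show ?thesis using that by auto
  qed
  let ?P = "{(1, 1), (1, 3), (1, 9), (3, 1), (9, 1)} :: (nat \<times> nat) set"
  let ?N = "{(1, 1), (1, 2), (1, 4), (2, 1), (4, 1)} :: (nat \<times> nat) set"
  have P: "{(x, y). x dvd 9 \<and> y dvd 9 \<and> gcd x y = 1} = ?P"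
    by (auto dest!: dvd_9)
  have N: "{(x, y). x dvd 4 \<and> y dvd 4 \<and> gcd x y = 1} = ?N"
    by (auto dest!: dvd_4)
  \<comment> \<open>65 is \<open>zm_quotient 8 4 2\<close>; the quotients for 1 and 4 are 585, a
    multiple of 9, and 1.\<close>
  have gcd_65: "gcd 3 65 = (1::int)" "gcd 9 65 = (1::int)" by (simp_all add: gcd_non_0_int)
  have "[8 ^ 4 = 1] (mod 9::nat)" by (simp add: cong_def)
  then have "int (factorization_number (ZM 9 4 8)) =
      (\<Sum>(m2, m3, n2, n3) \<in> {(m2, m3, n2, n3).
          m2 dvd 9 \<and> m3 dvd 9 \<and> n2 dvd 4 \<and> n3 dvd 4 \<and> gcd m2 m3 = 1 \<and> gcd n2 n3 = 1}.
        gcd (int m2) (zm_quotient 8 4 n2) * gcd (int m3) (zm_quotient 8 4 n3))"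
    by (intro formula) (simp_all add: gcd_non_0_nat)
  also have "\<dots> = (\<Sum>((m2, m3), (n2, n3)) \<in> {(x, y). x dvd 9 \<and> y dvd 9 \<and> gcd x y = 1} \<times>
        {(x, y). x dvd 4 \<and> y dvd 4 \<and> gcd x y = 1}.
      gcd (int m2) (zm_quotient 8 4 n2) * gcd (int m3) (zm_quotient 8 4 n3))"
    by (rule sum.reindex_bij_witness[of _ "\<lambda>((a, b), (c, d)). (a, b, c, d)"
          "\<lambda>(a, b, c, d). ((a, b), (c, d))"]) auto
  also have "\<dots> = 85"
    using gcd_65
    unfolding P N by (simp add: zm_quotient_def flip: sum.cartesian_product)
  finally have "factorization_number (ZM 9 4 8) = 85" by simp
  then show ?thesis by (intro conjI allI impI formula)
qed

end
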